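(* Let $\mathcal V$ be (the nerve of) the pair groupoid $\mathbb R^2\rightrightarrows\mathbb R$ of $\mathbb R$, regarded as a $\mathsf{VS}$ $2$-groupoid. Then the $2$-shifted pairing $\langle\cdot,\cdot\rangle:K^*(\mathcal V)_2\otimes\mathcal V_2=\mathcal V_2^*\otimes\mathcal V_2\to\mathbb R$ given by evaluation on $2$-simplices is not multiplicative.
   Context: Vector spaces are finite-dimensional over $\mathbb R$. For $m\ge1$, $0\le k\le m$, $\Lambda^m_k(\mathcal V)$ is the space of tuples $(x_0,\dots,\widehat{x_k},\dots,x_m)$ in $\mathcal V_{m-1}$ with $d_ix_j=d_{j-1}x_i$ for $i<j$, $i,j\neq k$; a $\mathsf{VS}$ $n$-groupoid is a simplicial vector space for which all maps $p^m_k:\mathcal V_m\to\Lambda^m_k(\mathcal V)$, $x\mapsto(d_ix)_{i\ne k}$, are surjective ($m\ge1$), and bijective for $m\ge n+1$. A $\mathsf{VS}$ $n$-groupoid is determined, up to isomorphism, by its $n$-truncation, and every $n$-truncated simplicial vector space extends to a $\mathsf{VS}$ $n$-groupoid. For a $\mathsf{VS}$ $2$-groupoid $\mathcal V$, $K^*(\mathcal V)$ is the $\mathsf{VS}$ $2$-groupoid with $2$-truncation $\mathcal V_2^*\rightrightarrows(\ker d^2_0)^*\rightrightarrows(\ker p^2_2)^*$ (levels $2,1,0$), where $\ker p^2_2=\ker d^2_0\cap\ker d^2_1\subseteq\mathcal V_2$, and structure maps as follows. For $\phi\in\mathcal V_2^*$, $\nu\in(\ker d^2_0)^*$, $\theta\in(\ker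 p^2_2)^*$, $v\in\mathcal V_2$, $h\in\ker d^2_0$, $k\in\ker p^2_2$ (and $1=s_0s_0:\mathcal V_0\to\mathcal V_2$): $(\check d^2_0\phi)(h)=\phi(h)$, $(\check d^2_1\phi)(h)=\phi(h-s_0d_1h)$, $(\check d^2_2\phi)(h)=\phi(h-s_0d_1h-s_1d_2h+1d_1d_1h)$, $(\check d^1_0\nu)(k)=\nu(k)$, $(\check d^1_1\nu)(k)=\nu(k-s_1d_2k)$, $(\check s^1_0\nu)(v)=\nu(v-s_0d_0v)$, $(\check s^1_1\nu)(v)=\nu(v-s_0d_0v-s_1d_1v+1d_0d_0v)$, $(\check s^0_0\theta)(h)=\theta(h-s_1d_1h)$. A pairing $\alpha_n:\mathcal W_n\otimes\mathcal V_n\to\mathbb R$ of simplicial vector spaces is multiplicative if $\sum_{i=0}^{n+1}(-1)^i\alpha_n(d_ix\otimes d_iy)=0$ for all $x\in\mathcal W_{n+1}$, $y\in\mathcal V_{n+1}$. For $n=2$ and $\mathsf{VS}$ $2$-groupoids this says $\langle\check m_1(\phi,\chi,\psi),m_1(W,Y,Z)\rangle=\langle\phi,W\rangle+\langle\chi,Y\rangle-\langle\psi,Z\rangle$ for all $(\phi,\chi,\psi)\in\Lambda^3_1(\mathcal W)$, $(W,Y,Z)\in\Lambda^3_1(\mathcal V)$, where $m_1=d_1\circ(p^3_1)^{-1}$ on $\mathcal V$ and $\check m_1=d_1\circ(p^3_1)^{-1}$ on $\mathcal W$. The pair groupoid of $\mathbb R$ has nerve with $\mathcal V_m=\mathbb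 R^{m+1}$, $d_i$ omitting and $s_i$ repeating the $i$-th coordinate. *)

theory Defs
  imports Complex_Main "HOL-Library.Function_Algebras" "HOL-Library.FuncSet"
begin

section \<open>Functions as a real vector space\<close>

instantiation "fun" :: (type, real_vector) real_vector
begin

definition scaleR_fun :: "real \<Rightarrow> ('a \<Rightarrow> 'b) \<Rightarrow> 'a \<Rightarrow> 'b" where
  "scaleR_fun c f = (\<lambda>x. c *\<^sub>R f x)"

instance
  by standard (auto simp: scaleR_fun_def plus_fun_def algebra_simps)

end

lemma scaleR_fun_apply [simp]: "(c *\<^sub>R f) x = c *\<^sub>R f x"
  by (simp add: scaleR_fun_def)

definition linear_on :: "'a::real_vector set \<Rightarrow> ('a \<Rightarrow> 'b::real_vector) \<Rightarrow> bool" where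
  "linear_on S f \<longleftrightarrow>
     (\<forall>x\<in>S. \<forall>y\<in>S. f (x + y) = f x + f y) \<and> (\<forall>c. \<forall>x\<in>S. f (c *\<^sub>R x) = c *\<^sub>R f x)"

definition fin_dim_subspace :: "'a::real_vector set \<Rightarrow> bool" where
  "fin_dim_subspace S \<longleftrightarrow> (\<exists>B. finite B \<and> span B = S)"

text \<open>A functional on the subspace \<open>S\<close> is represented by the unique function on the ambient type
  that agrees with it on \<open>S\<close> and is \<open>0\<close> outside \<open>S\<close>.\<close>

definition dual :: "'a::real_vector set \<Rightarrow> ('a \<Rightarrow> real) set" where
  "dual S = {\<phi>. linear_on S \<phi> \<and> (\<forall>x. x \<notin> S \<longrightarrow> \<phi> x = 0)}"


section \<open>Simplicial vector spaces\<close>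

text \<open>Both \<open>face V m i\<close> and \<open>degen V m i\<close> have source \<open>lev V m\<close>; only their values on
  \<open>lev V m\<close> for \<open>i \<le> m\<close> (and \<open>m \<ge> 1\<close> for faces) are meaningful.\<close>

record 'a simplicial =
  lev :: "nat \<Rightarrow> 'a set"
  face :: "nat \<Rightarrow> nat \<Rightarrow> 'a \<Rightarrow> 'a"
  degen :: "nat \<Rightarrow> nat \<Rightarrow> 'a \<Rightarrow> 'a"

definition simplicial_vs :: "'a::real_vector simplicial \<Rightarrow> bool" where
  "simplicial_vs V \<longleftrightarrow>
     (\<forall>m. fin_dim_subspace (lev V m)) \<and>
     (\<forall>m i. 1 \<le> m \<and> i \<le> m \<longrightarrow>
        face V m i ` lev V m \<subseteq> lev V (m - 1) \<and> linear_on (lev V m) (face V m i)) \<and>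
     (\<forall>m i. i \<le> m \<longrightarrow>
        degen V m i ` lev V m \<subseteq> lev V (m + 1) \<and> linear_on (lev V m) (degen V m i)) \<and>
     (\<forall>m i j. \<forall>x\<in>lev V m. 2 \<le> m \<and> i < j \<and> j \<le> m \<longrightarrow>
        face V (m - 1) i (face V m j x) = face V (m - 1) (j - 1) (face V m i x)) \<and>
     (\<forall>m i j. \<forall>x\<in>lev V m. i \<le> j \<and> j \<le> m \<longrightarrow>
        degen V (m + 1) i (degen V m j x) = degen V (m + 1) (j + 1) (degen V m i x)) \<and>
     (\<forall>m i j. \<forall>x\<in>lev V m. i < j \<and> j \<le> m \<longrightarrow>
        face V (m + 1) i (degen V m j x) = degen V (m - 1) (j - 1) (face V m i x)) \<and>
     (\<forall>m i j. \<forall>x\<in>lev V m. j \<le> m \<and> (i = j \<or> i = j + 1) \<longrightarrow>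
        face V (m + 1) i (degen V m j x) = x) \<and>
     (\<forall>m i j. \<forall>x\<in>lev V m. j + 1 < i \<and> i \<le> m + 1 \<longrightarrow>
        face V (m + 1) i (degen V m j x) = degen V (m - 1) j (face V m (i - 1) x))"

text \<open>The horn space of tuples \<open>(x\<^sub>0, \<dots>, x\<^sub>m)\<close> with the \<open>k\<close>-th entry omitted.\<close>

definition horn :: "'a::real_vector simplicial \<Rightarrow> nat \<Rightarrow> nat \<Rightarrow> (nat \<Rightarrow> 'a) set" where
  "horn V m k = {x \<in> ({..m} - {k}) \<rightarrow>\<^sub>E lev V (m - 1).
     \<forall>i\<in>{..m} - {k}. \<forall>j\<in>{..m} - {k}. i < j \<longrightarrow>
       face V (m - 1) i (x j) = face V (m - 1) (j - 1) (x i)}"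

definition horn_map :: "'a::real_vector simplicial \<Rightarrow> nat \<Rightarrow> nat \<Rightarrow> 'a \<Rightarrow> nat \<Rightarrow> 'a" where
  "horn_map V m k x = (\<lambda>i\<in>{..m} - {k}. face V m i x)"

definition VS_groupoid :: "nat \<Rightarrow> 'a::real_vector simplicial \<Rightarrow> bool" where
  "VS_groupoid n V \<longleftrightarrow> simplicial_vs V \<and>
     (\<forall>m k. 1 \<le> m \<and> k \<le> m \<longrightarrow> horn_map V m k ` lev V m = horn V m k) \<and>
     (\<forall>m k. n + 1 \<le> m \<and> k \<le> m \<longrightarrow> bij_betw (horn_map V m k) (lev V m) (horn V m k))"

definition multiplicative ::
  "nat \<Rightarrow> 'b::real_vector simplicial \<Rightarrow> 'a::real_vector simplicial \<Rightarrow> ('b \<Rightarrow> 'a \<Rightarrow> real) \<Rightarrow> bool" where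
  "multiplicative n W V \<alpha> \<longleftrightarrow>
     (\<forall>x\<in>lev W (n + 1). \<forall>y\<in>lev V (n + 1).
        (\<Sum>i\<le>n + 1. (- 1) ^ i * \<alpha> (face W (n + 1) i x) (face V (n + 1) i y)) = 0)"


definition evaluation :: "('a \<Rightarrow> real) \<Rightarrow> 'a \<Rightarrow> real" where
  "evaluation \<phi> v = \<phi> v"


section \<open>The 2-dual of a VS 2-groupoid\<close>

definition ker_d20 :: "'a::real_vector simplicial \<Rightarrow> 'a set" where
  "ker_d20 V = {h \<in> lev V 2. face V 2 0 h = 0}"

definition ker_p22 :: "'a::real_vector simplicial \<Rightarrow> 'a set" where
  "ker_p22 V = {k \<in> lev V 2. face V 2 0 k = 0 \<and> face V 2 1 k = 0}"

text \<open>\<open>is_K_star V W\<close>: \<open>W\<close> is a VS 2-groupoid with the prescribed 2-truncation (so \<open>W\<close> is a model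
  of the 2-dual of \<open>V\<close>, which is determined by this up to isomorphism). Since functionals vanish
  outside their domain, the structure maps are determined by the pointwise equations below.\<close>

definition is_K_star ::
  "'a::real_vector simplicial \<Rightarrow> ('a \<Rightarrow> real) simplicial \<Rightarrow> bool" where
  "is_K_star V W \<longleftrightarrow> VS_groupoid 2 W \<and>
     lev W 2 = dual (lev V 2) \<and> lev W 1 = dual (ker_d20 V) \<and> lev W 0 = dual (ker_p22 V) \<and>
     (let d = face V 2; s0 = degen V 1 0; s1 = degen V 1 1;
          d1 = face V 1; one = (\<lambda>u. degen V 1 0 (degen V 0 0 u))
      in
       (\<forall>\<phi>\<in>lev W 2. \<forall>h\<in>ker_d20 V.
          face W 2 0 \<phi> h = \<phi> h \<and>
          face W 2 1 \<phi> h = \<phi> (h - s0 (d 1 h)) \<and>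
          face W 2 2 \<phi> h = \<phi> (h - s0 (d 1 h) - s1 (d 2 h) + one (d1 1 (d 1 h)))) \<and>
       (\<forall>\<nu>\<in>lev W 1. \<forall>k\<in>ker_p22 V.
          face W 1 0 \<nu> k = \<nu> k \<and>
          face W 1 1 \<nu> k = \<nu> (k - s1 (d 2 k))) \<and>
       (\<forall>\<nu>\<in>lev W 1. \<forall>v\<in>lev V 2.
          degen W 1 0 \<nu> v = \<nu> (v - s0 (d 0 v)) \<and>
          degen W 1 1 \<nu> v = \<nu> (v - s0 (d 0 v) - s1 (d 1 v) + one (d1 0 (d 0 v)))) \<and>
       (\<forall>\<theta>\<in>lev W 0. \<forall>h\<in>ker_d20 V.
          degen W 0 0 \<theta> h = \<theta> (h - s1 (d 1 h))))"


section \<open>The nerve of the pair groupoid of the reals\<close>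

text \<open>The space \<open>\<real>\<^sup>m\<^sup>+\<^sup>1\<close> is the space of real sequences supported on \<open>{0..m}\<close>.\<close>

definition cof :: "nat \<Rightarrow> nat \<Rightarrow> nat" where
  "cof i a = (if a < i then a else a + 1)"

definition codeg :: "nat \<Rightarrow> nat \<Rightarrow> nat" where
  "codeg i a = (if a \<le> i then a else a - 1)"

definition pair_nerve :: "(nat \<Rightarrow> real) simplicial" where
  "pair_nerve = \<lparr>
     lev = (\<lambda>m. {x. \<forall>a>m. x a = 0}),
     face = (\<lambda>m i x a. x (cof i a)),
     degen = (\<lambda>m i x a. x (codeg i a))\<rparr>"


section \<open>The pair groupoid is a VS 2-groupoid\<close>

lemma VS_groupoid_mono: "VS_groupoid n V \<Longrightarrow> n \<le> n' \<Longrightarrow> VS_groupoid n' V"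
  by (auto simp: VS_groupoid_def)

lemma fin_dim_finite_support:
  assumes "finite A"
  shows "fin_dim_subspace {x :: 'k \<Rightarrow> real. \<forall>a. a \<notin> A \<longrightarrow> x a = 0}"
proof -
  define e :: "'k \<Rightarrow> 'k \<Rightarrow> real" where "e = (\<lambda>a b. if b = a then 1 else 0)"
  have "span (e ` A) = {x. \<forall>a. a \<notin> A \<longrightarrow> x a = 0}" (is "_ = ?S")
  proof
    have "subspace ?S"
      by (auto simp: subspace_def plus_fun_def zero_fun_def)
    moreover have "e ` A \<subseteq> ?S"
      by (auto simp: e_def)
    ultimately show "span (e ` A) \<subseteq> ?S"
      by (rule span_minimal[rotated])
    show "?S \<subseteq> span (e ` A)"
    proof
      fix x assume x: "x \<in> ?S"
      have ap: "(\<Sum>a\<in>B. f a) b = (\<Sum>a\<in>B. f a b)" if "finite B" for B b and f :: "'k \<Rightarrow> 'k \<Rightarrow> real"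
        using that by (induction B) (auto simp: plus_fun_def zero_fun_def)
      have "x = (\<Sum>a\<in>A. x a *\<^sub>R e a)"
      proof
        fix b
        have "(\<Sum>a\<in>A. x a * e a b) = (\<Sum>a\<in>A. if b = a then x a else 0)"
          by (rule sum.cong) (auto simp: e_def)
        also have "\<dots> = x b"
          using assms x by auto
        finally show "x b = (\<Sum>a\<in>A. x a *\<^sub>R e a) b"
          using assms by (simp add: ap)
      qed
      moreover have "(\<Sum>a\<in>A. x a *\<^sub>R e a) \<in> span (e ` A)"
        by (intro span_sum span_scale span_base) auto
      ultimately show "x \<in> span (e ` A)" by simp
    qed
  qed
  with assms show ?thesis
    unfolding fin_dim_subspace_def by blast
qed

lemma horn_map_in_horn:
  assumes V: "simplicial_vs V" and m: "1 \<le> m" "k \<le> m" and x: "x \<in> lev V m"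
  shows "horn_map V m k x \<in> horn V m k"
proof -
  note S = V[unfolded simplicial_vs_def]
  note S2 = S[THEN conjunct2, THEN conjunct1, rule_format]
    and S4 = S[THEN conjunct2, THEN conjunct2, THEN conjunct2, THEN conjunct1, rule_format]
  have "face V m i x \<in> lev V (m - 1)" if "i \<le> m" for i
    using S2[of m i] m x that by auto
  moreover have "face V (m - 1) i (face V m j x) = face V (m - 1) (j - 1) (face V m i x)"
    if "i < j" "j \<le> m" "2 \<le> m" for i j
    using S4[OF x, of i j] that by simp
  moreover have "2 \<le> m" if "i \<le> m" "j \<le> m" "i \<noteq> k" "j \<noteq> k" "i < j" for i j
    using that m by linarith
  ultimately show ?thesis
    unfolding horn_def horn_map_def by auto
qed

definition cof_inv :: "nat \<Rightarrow> nat \<Rightarrow> nat" where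
  "cof_inv i a = (if a < i then a else a - 1)"

lemma cof_inv_cof [simp]: "cof_inv i (cof i a) = a"
  by (auto simp: cof_inv_def cof_def)

lemma cof_cof_inv: "a \<noteq> i \<Longrightarrow> cof i (cof_inv i a) = a"
  by (auto simp: cof_inv_def cof_def)

lemma cof_neq: "cof i a \<noteq> i" "i \<noteq> cof i a"
  by (auto simp: cof_def)

lemma cof_cof: "i < j \<Longrightarrow> cof j (cof i a) = cof i (cof (j - 1) a)"
  by (auto simp: cof_def)

lemma codeg_codeg: "i \<le> j \<Longrightarrow> codeg j (codeg i a) = codeg i (codeg (j + 1) a)"
  by (auto simp: codeg_def)

lemma codeg_cof1: "i < j \<Longrightarrow> codeg j (cof i a) = cof i (codeg (j - 1) a)"
  by (auto simp: cof_def codeg_def)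

lemma codeg_cof2: "i = j \<or> i = j + 1 \<Longrightarrow> codeg j (cof i a) = a"
  by (auto simp: cof_def codeg_def)

lemma codeg_cof3: "j + 1 < i \<Longrightarrow> codeg j (cof i a) = cof (i - 1) (codeg j a)"
  by (auto simp: cof_def codeg_def)

lemma cof_inv_cof_inv:
  assumes "i < j" "a \<noteq> i" "a \<noteq> j"
  shows "cof_inv i (cof_inv j a) = cof_inv (j - 1) (cof_inv i a)"
    and "cof_inv j a \<noteq> i" and "cof_inv i a \<noteq> j - 1"
  using assms by (auto simp: cof_inv_def)

lemma simplicial_vs_pair_nerve: "simplicial_vs pair_nerve"
proof -
  have *: "fin_dim_subspace {x::nat \<Rightarrow> real. \<forall>a>m. x a = 0}" for m
    using fin_dim_finite_support[of "{..m}"] by (simp add: not_le)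
  show ?thesis
    unfolding simplicial_vs_def pair_nerve_def
    by (auto simp: * linear_on_def plus_fun_def scaleR_fun_def fun_eq_iff
          cof_cof codeg_codeg codeg_cof1 codeg_cof2 codeg_cof3)
      (auto simp: cof_def codeg_def)
qed

lemma pair_nerve_fill:
  assumes "1 \<le> m" "k \<le> m" and y: "y \<in> horn pair_nerve m k"
  shows "y \<in> horn_map pair_nerve m k ` lev pair_nerve m"
proof -
  have y1: "y i b = 0" if "i \<le> m" "i \<noteq> k" "b > m - 1" for i b
    using y that by (auto simp: horn_def pair_nerve_def PiE_def Pi_def)
  have y2: "y j (cof i b) = y i (cof (j - 1) b)"
    if "i \<le> m" "i \<noteq> k" "j \<le> m" "j \<noteq> k" "i < j" for i j b
    using y that by (auto simp: horn_def pair_nerve_def fun_eq_iff)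
  have y3: "y i = undefined" if "\<not> (i \<le> m \<and> i \<noteq> k)" for i
    using y that by (auto simp: horn_def PiE_def extensional_def)
  have ind0: "y j (cof_inv j a) = y i (cof_inv i a)"
    if "i \<le> m" "i \<noteq> k" "j \<le> m" "j \<noteq> k" "i < j" "a \<noteq> i" "a \<noteq> j" for i j a
  proof -
    note c = cof_inv_cof_inv[OF that(5-7)]
    have "y j (cof_inv j a) = y j (cof i (cof_inv i (cof_inv j a)))"
      using c(2) by (simp add: cof_cof_inv)
    also have "\<dots> = y i (cof (j - 1) (cof_inv (j - 1) (cof_inv i a)))"
      using y2[OF that(1-5), of "cof_inv i (cof_inv j a)"] by (simp only: c(1))
    also have "\<dots> = y i (cof_inv i a)"
      by (simp only: cof_cof_inv[OF c(3)])
    finally show ?thesis .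
  qed
  have ind: "y j (cof_inv j a) = y i (cof_inv i a)"
    if "i \<le> m" "i \<noteq> k" "j \<le> m" "j \<noteq> k" "a \<noteq> i" "a \<noteq> j" for i j a
  proof (cases i j rule: linorder_cases)
    case less
    show ?thesis by (rule ind0[OF that(1-4) less that(5,6)])
  next
    case greater
    show ?thesis by (rule ind0[OF that(3,4,1,2) greater that(6,5), symmetric])
  qed simp
  define P where "P a j \<longleftrightarrow> j \<le> m \<and> j \<noteq> k \<and> j \<noteq> a" for a j
  define J where "J a = (SOME j. P a j)" for a
  define x where "x a = (if a \<le> m \<and> Ex (P a) then y (J a) (cof_inv (J a) a) else 0)" for a
  have xy: "x a = y i (cof_inv i a)" if "a \<le> m" "i \<le> m" "i \<noteq> k" "i \<noteq> a" for a i
  proof -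
    have "P a i" using that by (auto simp: P_def)
    then have "P a (J a)" unfolding J_def by (rule someI)
    then have "y (J a) (cof_inv (J a) a) = y i (cof_inv i a)"
      using that by (intro ind) (auto simp: P_def)
    then show ?thesis
      using that \<open>P a i\<close> unfolding x_def by auto
  qed
  have "x \<in> lev pair_nerve m"
    by (auto simp: pair_nerve_def x_def)
  moreover have "y = horn_map pair_nerve m k x"
  proof
    fix i
    show "y i = horn_map pair_nerve m k x i"
    proof (cases "i \<le> m \<and> i \<noteq> k")
      case True
      have "x (cof i b) = y i b" for b
      proof (cases "b \<le> m - 1")
        case b: True
        have "cof i b \<le> m" using b assms by (auto simp: cof_def)
        then show ?thesis using xy[of "cof i b" i] True by (simp add: cof_neq)
      next
        case False
        moreover from this have "cof i b > m" using True assms by (auto simp: cof_def)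
        ultimately show ?thesis using y1[of i b] True by (simp add: x_def)
      qed
      with True show ?thesis
        by (auto simp: horn_map_def pair_nerve_def fun_eq_iff)
    next
      case False
      then show ?thesis by (auto simp: y3 horn_map_def)
    qed
  qed
  ultimately show ?thesis by blast
qed

lemma VS_groupoid_pair_nerve: "VS_groupoid 1 pair_nerve"
proof -
  have surj: "horn_map pair_nerve m k ` lev pair_nerve m = horn pair_nerve m k"
    if "1 \<le> m" "k \<le> m" for m k
    using horn_map_in_horn[OF simplicial_vs_pair_nerve that] pair_nerve_fill[OF that] by blast
  have inj: "inj_on (horn_map pair_nerve m k) (lev pair_nerve m)"
    if m: "2 \<le> m" "k \<le> m" for m k
  proof (rule inj_onI)
    fix x y assume x: "x \<in> lev pair_nerve m" and y: "y \<in> lev pair_nerve m"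
      and eq: "horn_map pair_nerve m k x = horn_map pair_nerve m k y"
    show "x = y"
    proof
      fix a
      have "\<exists>j\<in>{0, 1, 2}. j \<noteq> k \<and> j \<noteq> a" by auto
      then obtain j where j: "j \<in> {0, 1, 2}" "j \<noteq> k" "j \<noteq> a" by blast
      from j(1) have "j \<le> m" using m by auto
      have "horn_map pair_nerve m k x j (cof_inv j a) = horn_map pair_nerve m k y j (cof_inv j a)"
        by (simp add: eq)
      then show "x a = y a"
        using j \<open>j \<le> m\<close> by (simp add: horn_map_def pair_nerve_def cof_cof_inv)
    qed
  qed
  show ?thesis
    unfolding VS_groupoid_def
    using simplicial_vs_pair_nerve surj inj by (auto simp: bij_betw_def)
qed

corollary VS_2_groupoid_pair_nerve: "VS_groupoid 2 pair_nerve"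
  using VS_groupoid_mono[OF VS_groupoid_pair_nerve] by simp

section \<open>Existence of the 2-dual of the pair groupoid\<close>

text \<open>The model has coordinates \<open>x (a, b)\<close>, \<open>a < b \<le> m\<close>, in level \<open>m\<close>; these are reindexed along
  monotone maps, with \<open>x (a, a) = 0\<close>. It is then moved along \<open>enc\<close> to get the prescribed levels 0, 1, 2.\<close>

definition edge_model :: "(nat \<times> nat \<Rightarrow> real) simplicial" where
  "edge_model = \<lparr>
     lev = (\<lambda>m. {x. \<forall>a b. \<not> (a < b \<and> b \<le> m) \<longrightarrow> x (a, b) = 0}),
     face = (\<lambda>m i x (a, b). x (cof i a, cof i b)),
     degen = (\<lambda>m i x (a, b). x (codeg i a, codeg i b))\<rparr>"

lemma simplicial_vs_edge_model: "simplicial_vs edge_model"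
proof -
  have *: "fin_dim_subspace {x::nat \<times> nat \<Rightarrow> real. \<forall>a b. \<not> (a < b \<and> b \<le> m) \<longrightarrow> x (a, b) = 0}" for m
  proof -
    have "finite {(a, b). a < b \<and> b \<le> m}"
      by (rule finite_subset[of _ "{..m} \<times> {..m}"]) auto
    from fin_dim_finite_support[OF this] show ?thesis by simp
  qed
  have fd: "fin_dim_subspace (lev edge_model m)" for m
    using * by (simp add: edge_model_def)
  have F: "face edge_model m i ` lev edge_model m \<subseteq> lev edge_model (m - 1)"
    if "1 \<le> m \<and> i \<le> m" for m i
  proof -
    have "\<not> (cof i a < cof i b \<and> cof i b \<le> m)" if "\<not> (a < b \<and> b \<le> m - 1)" for a b
      using that \<open>1 \<le> m \<and> i \<le> m\<close> by (auto simp: cof_def)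
    then have "x (cof i a, cof i b) = 0"
      if "x \<in> lev edge_model m" "\<not> (a < b \<and> b \<le> m - 1)" for x a b
      using that unfolding edge_model_def by simp
    then show ?thesis
      by (intro image_subsetI) (simp add: edge_model_def)
  qed
  have D: "degen edge_model m i ` lev edge_model m \<subseteq> lev edge_model (m + 1)"
    if "i \<le> m" for m i
  proof -
    have "\<not> (codeg i a < codeg i b \<and> codeg i b \<le> m)" if "\<not> (a < b \<and> b \<le> m + 1)" for a b
      using that \<open>i \<le> m\<close> by (auto simp: codeg_def)
    then have "x (codeg i a, codeg i b) = 0"
      if "x \<in> lev edge_model m" "\<not> (a < b \<and> b \<le> m + 1)" for x a b
      using that unfolding edge_model_def by simp
    then show ?thesis
      by (intro image_subsetI) (simp add: edge_model_def)
  qed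
  have lin: "linear_on S (face edge_model m i)" "linear_on S (degen edge_model m i)" for S m i
    by (auto simp: linear_on_def edge_model_def fun_eq_iff)
  have ff: "face edge_model m' i (face edge_model m j x)
      = face edge_model m' (j - 1) (face edge_model m i x)" if "i < j" for m m' i j x
    using that by (simp add: edge_model_def fun_eq_iff cof_cof)
  have dd: "degen edge_model m' i (degen edge_model m j x)
      = degen edge_model m' (j + 1) (degen edge_model m i x)" if "i \<le> j" for m m' i j x
    using codeg_codeg[OF that] by (simp add: edge_model_def fun_eq_iff)
  have fd1: "face edge_model m' i (degen edge_model m j x)
      = degen edge_model m'' (j - 1) (face edge_model m i x)" if "i < j" for m m' m'' i j x
    using that by (simp add: edge_model_def fun_eq_iff codeg_cof1)
  have fd2: "face edge_model m' i (degen edge_model m j x) = x"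
    if "i = j \<or> i = j + 1" for m m' i j x
    using codeg_cof2[OF that] by (simp add: edge_model_def fun_eq_iff)
  have fd3: "face edge_model m' i (degen edge_model m j x)
      = degen edge_model m'' j (face edge_model m (i - 1) x)" if "j + 1 < i" for m m' m'' i j x
    using codeg_cof3[OF that] by (simp add: edge_model_def fun_eq_iff)
  show ?thesis
    unfolding simplicial_vs_def
  proof (intro conjI, goal_cases)
    case 1 show ?case using fd by blast
  next
    case 2 show ?case by (intro allI impI conjI F lin) auto
  next
    case 3 show ?case by (intro allI impI conjI D lin)
  next
    case 4 show ?case by (intro allI ballI impI ff) auto
  next
    case 5 show ?case by (intro allI ballI impI dd) auto
  next
    case 6 show ?case by (intro allI ballI impI fd1) auto
  next
    case 7 show ?case by (intro allI ballI impI fd2) auto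
  next
    case 8 show ?case by (intro allI ballI impI fd3) auto
  qed
qed

lemma edge_model_fill:
  assumes "1 \<le> m" "k \<le> m" and y: "y \<in> horn edge_model m k"
  shows "y \<in> horn_map edge_model m k ` lev edge_model m"
proof -
  have y1: "y i (a, b) = 0" if "i \<le> m" "i \<noteq> k" "\<not> (a < b \<and> b \<le> m - 1)" for i a b
  proof -
    have "y i \<in> lev edge_model (m - 1)" using y that by (auto simp: horn_def)
    with that show ?thesis by (auto simp: edge_model_def)
  qed
  have y2: "y j (cof i a, cof i b) = y i (cof (j - 1) a, cof (j - 1) b)"
    if "i \<le> m" "i \<noteq> k" "j \<le> m" "j \<noteq> k" "i < j" for i j a b
  proof -
    have "face edge_model (m - 1) i (y j) = face edge_model (m - 1) (j - 1) (y i)"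
      using y that by (auto simp: horn_def)
    from fun_cong[OF this, of "(a, b)"] show ?thesis by (simp add: edge_model_def)
  qed
  have y3: "y i = undefined" if "\<not> (i \<le> m \<and> i \<noteq> k)" for i
    using y that by (auto simp: horn_def PiE_def extensional_def)
  have ind0: "y j (cof_inv j a, cof_inv j b) = y i (cof_inv i a, cof_inv i b)"
    if "i \<le> m" "i \<noteq> k" "j \<le> m" "j \<noteq> k" "i < j" "a \<noteq> i" "a \<noteq> j" "b \<noteq> i" "b \<noteq> j" for i j a b
  proof -
    note c = cof_inv_cof_inv[OF that(5-7)] and d = cof_inv_cof_inv[OF that(5,8,9)]
    have "y j (cof_inv j a, cof_inv j b)
        = y j (cof i (cof_inv i (cof_inv j a)), cof i (cof_inv i (cof_inv j b)))"
      using c(2) d(2) by (simp add: cof_cof_inv)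
    also have "\<dots> = y i (cof (j - 1) (cof_inv (j - 1) (cof_inv i a)),
                        cof (j - 1) (cof_inv (j - 1) (cof_inv i b)))"
      using y2[OF that(1-5), of "cof_inv i (cof_inv j a)" "cof_inv i (cof_inv j b)"]
      by (simp only: c(1) d(1))
    also have "\<dots> = y i (cof_inv i a, cof_inv i b)"
      by (simp only: cof_cof_inv[OF c(3)] cof_cof_inv[OF d(3)])
    finally show ?thesis .
  qed
  have ind: "y j (cof_inv j a, cof_inv j b) = y i (cof_inv i a, cof_inv i b)"
    if "i \<le> m" "i \<noteq> k" "j \<le> m" "j \<noteq> k" "a \<noteq> i" "a \<noteq> j" "b \<noteq> i" "b \<noteq> j" for i j a b
  proof (cases i j rule: linorder_cases)
    case less
    show ?thesis by (rule ind0[OF that(1-4) less that(5-8)])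
  next
    case greater
    show ?thesis by (rule ind0[OF that(3,4,1,2) greater that(6,5,8,7), symmetric])
  qed simp
  define P where "P a b j \<longleftrightarrow> j \<le> m \<and> j \<noteq> k \<and> j \<noteq> a \<and> j \<noteq> b" for a b j
  define J where "J a b = (SOME j. P a b j)" for a b
  define x where "x = (\<lambda>(a, b). if a < b \<and> b \<le> m \<and> Ex (P a b)
     then y (J a b) (cof_inv (J a b) a, cof_inv (J a b) b) else 0)"
  have xy: "x (a, b) = y i (cof_inv i a, cof_inv i b)"
    if "a < b" "b \<le> m" "i \<le> m" "i \<noteq> k" "i \<noteq> a" "i \<noteq> b" for a b i
  proof -
    have "P a b i" using that by (auto simp: P_def)
    then have "P a b (J a b)" unfolding J_def by (rule someI)
    then have "y (J a b) (cof_inv (J a b) a, cof_inv (J a b) b) = y i (cof_inv i a, cof_inv i b)"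
      using that by (intro ind) (auto simp: P_def)
    then show ?thesis
      using that \<open>P a b i\<close> unfolding x_def by auto
  qed
  have "x \<in> lev edge_model m"
    by (auto simp: edge_model_def x_def)
  moreover have "y = horn_map edge_model m k x"
  proof
    fix i
    show "y i = horn_map edge_model m k x i"
    proof (cases "i \<le> m \<and> i \<noteq> k")
      case True
      have "x (cof i a, cof i b) = y i (a, b)" for a b
      proof (cases "a < b \<and> b \<le> m - 1")
        case b: True
        have "cof i a < cof i b" "cof i b \<le> m" using b assms by (auto simp: cof_def)
        then show ?thesis using xy[of "cof i a" "cof i b" i] True by (simp add: cof_neq)
      next
        case False
        moreover from this have "\<not> (cof i a < cof i b \<and> cof i b \<le> m)"
          using True assms by (auto simp: cof_def split: if_splits)
        ultimately show ?thesis using y1[of i a b] True by (auto simp: x_def)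
      qed
      with True show ?thesis
        by (auto simp: horn_map_def edge_model_def fun_eq_iff)
    next
      case False
      then show ?thesis by (auto simp: y3 horn_map_def)
    qed
  qed
  ultimately show ?thesis by blast
qed

lemma VS_groupoid_edge_model: "VS_groupoid 2 edge_model"
proof -
  have surj: "horn_map edge_model m k ` lev edge_model m = horn edge_model m k"
    if "1 \<le> m" "k \<le> m" for m k
    using horn_map_in_horn[OF simplicial_vs_edge_model that] edge_model_fill[OF that] by blast
  have inj: "inj_on (horn_map edge_model m k) (lev edge_model m)"
    if m: "3 \<le> m" "k \<le> m" for m k
  proof (rule inj_onI)
    fix x y assume x: "x \<in> lev edge_model m" and y: "y \<in> lev edge_model m"
      and eq: "horn_map edge_model m k x = horn_map edge_model m k y"
    have "x (a, b) = y (a, b)" for a b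
    proof -
      have "\<exists>j\<in>{0, 1, 2, 3}. j \<noteq> k \<and> j \<noteq> a \<and> j \<noteq> b" by auto
      then obtain j where j: "j \<in> {0, 1, 2, 3}" "j \<noteq> k" "j \<noteq> a" "j \<noteq> b" by blast
      from j(1) have "j \<le> m" using m by auto
      have "horn_map edge_model m k x j (cof_inv j a, cof_inv j b)
          = horn_map edge_model m k y j (cof_inv j a, cof_inv j b)"
        by (simp add: eq)
      then show ?thesis
        using j \<open>j \<le> m\<close> by (simp add: horn_map_def edge_model_def cof_cof_inv)
    qed
    then show "x = y" by auto
  qed
  show ?thesis
    unfolding VS_groupoid_def
    using simplicial_vs_edge_model surj inj by (auto simp: bij_betw_def)
qed

definition transport ::
  "(nat \<Rightarrow> 'a \<Rightarrow> 'b) \<Rightarrow> (nat \<Rightarrow> 'b \<Rightarrow> 'a) \<Rightarrow> 'a::real_vector simplicial \<Rightarrow> 'b::real_vector simplicial" where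
  "transport e g V = \<lparr>
     lev = (\<lambda>m. e m ` lev V m),
     face = (\<lambda>m i y. e (m - 1) (face V m i (g m y))),
     degen = (\<lambda>m i y. e (m + 1) (degen V m i (g m y)))\<rparr>"

lemma VS_groupoid_transport:
  assumes V: "VS_groupoid n V" and e: "\<And>m. linear (e m)"
    and g: "\<And>m x. x \<in> lev V m \<Longrightarrow> g m (e m x) = x"
  shows "VS_groupoid n (transport e g V)"
proof -
  let ?W = "transport e g V"
  note S = V[unfolded VS_groupoid_def, THEN conjunct1, unfolded simplicial_vs_def]
  note G2 = V[unfolded VS_groupoid_def, THEN conjunct2, THEN conjunct1, rule_format]
    and G3 = V[unfolded VS_groupoid_def, THEN conjunct2, THEN conjunct2, rule_format]
  note S1 = S[THEN conjunct1, rule_format]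
    and S2 = S[THEN conjunct2, THEN conjunct1, rule_format]
    and S3 = S[THEN conjunct2, THEN conjunct2, THEN conjunct1, rule_format]
    and S4 = S[THEN conjunct2, THEN conjunct2, THEN conjunct2, THEN conjunct1, rule_format]
    and S5 = S[THEN conjunct2, THEN conjunct2, THEN conjunct2, THEN conjunct2, THEN conjunct1, rule_format]
    and S6 = S[THEN conjunct2, THEN conjunct2, THEN conjunct2, THEN conjunct2, THEN conjunct2, THEN conjunct1, rule_format]
    and S7 = S[THEN conjunct2, THEN conjunct2, THEN conjunct2, THEN conjunct2, THEN conjunct2, THEN conjunct2, THEN conjunct1, rule_format]
    and S8 = S[THEN conjunct2, THEN conjunct2, THEN conjunct2, THEN conjunct2, THEN conjunct2, THEN conjunct2, THEN conjunct2, rule_format]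
  have fd: "fin_dim_subspace (lev V m)" for m by (rule S1)
  then have sub: "subspace (lev V m)" for m
    unfolding fin_dim_subspace_def by (metis subspace_span)
  have F: "face V m i x \<in> lev V (m - 1)" if "1 \<le> m" "i \<le> m" "x \<in> lev V m" for m i x
    using S2[of m i] that by auto
  have D: "degen V m i x \<in> lev V (m + 1)" if "i \<le> m" "x \<in> lev V m" for m i x
    using S3[of i m] that by auto
  have lin: "linear_on (e m ` lev V m) (\<lambda>y. e m' (f (g m y)))" if "linear_on (lev V m) f" for m m' f
  proof -
    have "g m (e m x + e m x') = x + x'" if "x \<in> lev V m" "x' \<in> lev V m" for x x'
      using that sub[of m] by (simp add: g subspace_add flip: linear_add[OF e])
    moreover have "g m (c *\<^sub>R e m x) = c *\<^sub>R x" if "x \<in> lev V m" for c x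
      using that sub[of m] by (simp add: g subspace_scale flip: linear_scale[OF e])
    ultimately show ?thesis
      using that unfolding linear_on_def by (auto simp: g linear_add[OF e] linear_scale[OF e])
  qed
  have WF: "face ?W m i (e m x) = e (m - 1) (face V m i x)" if "x \<in> lev V m" for m i x
    using that by (simp add: transport_def g)
  have WD: "degen ?W m i (e m x) = e (m + 1) (degen V m i x)" if "x \<in> lev V m" for m i x
    using that by (simp add: transport_def g)
  have Wl: "lev ?W m = e m ` lev V m" for m by (simp add: transport_def)
  have 1: "fin_dim_subspace (lev ?W m)" for m
  proof -
    obtain B where "finite B" "span B = lev V m" using fd[of m] unfolding fin_dim_subspace_def by blast
    then have "finite (e m ` B)" "span (e m ` B) = lev ?W m"
      by (auto simp: Wl linear_span_image[OF e])
    then show ?thesis unfolding fin_dim_subspace_def by blast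
  qed
  have 2: "face ?W m i ` lev ?W m \<subseteq> lev ?W (m - 1) \<and> linear_on (lev ?W m) (face ?W m i)"
    if "1 \<le> m \<and> i \<le> m" for m i
  proof
    show "face ?W m i ` lev ?W m \<subseteq> lev ?W (m - 1)"
      using that F by (auto simp: Wl WF)
    have "linear_on (lev V m) (face V m i)" using S2[of m i] that by simp
    from lin[OF this] show "linear_on (lev ?W m) (face ?W m i)"
      by (simp add: transport_def)
  qed
  have 3: "degen ?W m i ` lev ?W m \<subseteq> lev ?W (m + 1) \<and> linear_on (lev ?W m) (degen ?W m i)"
    if "i \<le> m" for m i
  proof
    show "degen ?W m i ` lev ?W m \<subseteq> lev ?W (m + 1)"
      using that D by (auto simp: Wl WD)
    have "linear_on (lev V m) (degen V m i)" using S3[of i m] that by simp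
    from lin[OF this] show "linear_on (lev ?W m) (degen ?W m i)"
      by (simp add: transport_def)
  qed
  have 4: "face ?W (m - 1) i (face ?W m j y) = face ?W (m - 1) (j - 1) (face ?W m i y)"
    if y: "y \<in> lev ?W m" and c: "2 \<le> m \<and> i < j \<and> j \<le> m" for m i j y
  proof -
    obtain x where x: "x \<in> lev V m" "y = e m x" using y by (auto simp: Wl)
    have "face V (m - 1) i (face V m j x) = face V (m - 1) (j - 1) (face V m i x)"
      using x(1) c by (rule S4)
    then show ?thesis using x c WF[OF F, of m] by (simp add: WF)
  qed
  have 5: "degen ?W (m + 1) i (degen ?W m j y) = degen ?W (m + 1) (j + 1) (degen ?W m i y)"
    if y: "y \<in> lev ?W m" and c: "i \<le> j \<and> j \<le> m" for m i j y
  proof -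
    obtain x where x: "x \<in> lev V m" "y = e m x" using y by (auto simp: Wl)
    have "degen V (m + 1) i (degen V m j x) = degen V (m + 1) (j + 1) (degen V m i x)"
      using x(1) c by (rule S5)
    then show ?thesis using x c WD[OF D, of _ m] by (simp add: WD)
  qed
  have 6: "face ?W (m + 1) i (degen ?W m j y) = degen ?W (m - 1) (j - 1) (face ?W m i y)"
    if y: "y \<in> lev ?W m" and c: "i < j \<and> j \<le> m" for m i j y
  proof -
    obtain x where x: "x \<in> lev V m" "y = e m x" using y by (auto simp: Wl)
    have "face V (m + 1) i (degen V m j x) = degen V (m - 1) (j - 1) (face V m i x)"
      using x(1) c by (rule S6)
    then show ?thesis using x c WF[OF D, of _ m] WD[OF F, of m] by (simp add: WD WF)
  qed
  have 7: "face ?W (m + 1) i (degen ?W m j y) = y"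
    if y: "y \<in> lev ?W m" and c: "j \<le> m \<and> (i = j \<or> i = j + 1)" for m i j y
  proof -
    obtain x where x: "x \<in> lev V m" "y = e m x" using y by (auto simp: Wl)
    have "face V (m + 1) i (degen V m j x) = x"
      using x(1) c by (rule S7)
    then show ?thesis using x c WF[OF D, of _ m] by (simp add: WD)
  qed
  have 8: "face ?W (m + 1) i (degen ?W m j y) = degen ?W (m - 1) j (face ?W m (i - 1) y)"
    if y: "y \<in> lev ?W m" and c: "j + 1 < i \<and> i \<le> m + 1" for m i j y
  proof -
    obtain x where x: "x \<in> lev V m" "y = e m x" using y by (auto simp: Wl)
    have "face V (m + 1) i (degen V m j x) = degen V (m - 1) j (face V m (i - 1) x)"
      using x(1) c by (rule S8)
    moreover have "degen ?W (m - 1) j (e (m - 1) (face V m (i - 1) x))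
        = e (m - 1 + 1) (degen V (m - 1) j (face V m (i - 1) x))"
      using c x by (intro WD F) auto
    ultimately show ?thesis using x c WF[OF D, of _ m] by (simp add: WD WF)
  qed
  have simp: "simplicial_vs ?W"
    unfolding simplicial_vs_def using 1 2 3 4 5 6 7 8 by simp
  have hm: "horn_map ?W m k (e m x) = (\<lambda>i\<in>{..m} - {k}. e (m - 1) (horn_map V m k x i))"
    if "x \<in> lev V m" for m k x
    using that by (auto simp: horn_map_def WF)
  have surj: "horn_map ?W m k ` lev ?W m = horn ?W m k" if m: "1 \<le> m" "k \<le> m" for m k
  proof
    show "horn_map ?W m k ` lev ?W m \<subseteq> horn ?W m k"
      using horn_map_in_horn[OF simp m] by blast
    show "horn ?W m k \<subseteq> horn_map ?W m k ` lev ?W m"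
    proof
      fix y assume y: "y \<in> horn ?W m k"
      define z where "z = (\<lambda>i\<in>{..m} - {k}. g (m - 1) (y i))"
      have yz: "y i = e (m - 1) (z i) \<and> z i \<in> lev V (m - 1)" if "i \<in> {..m} - {k}" for i
      proof -
        have "y i \<in> lev ?W (m - 1)" using y that by (auto simp: horn_def)
        then show ?thesis using that by (auto simp: Wl g z_def)
      qed
      have "face V (m - 1) i (z j) = face V (m - 1) (j - 1) (z i)"
        if i: "i \<in> {..m} - {k}" and j: "j \<in> {..m} - {k}" and ij: "i < j" for i j
      proof -
        have m2: "2 \<le> m" using i j ij m by auto
        have "face ?W (m - 1) i (y j) = face ?W (m - 1) (j - 1) (y i)"
          using y i j ij by (auto simp: horn_def)
        then have "e (m - 1 - 1) (face V (m - 1) i (z j))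
            = e (m - 1 - 1) (face V (m - 1) (j - 1) (z i))"
          using yz[OF i] yz[OF j] by (simp add: WF del: diff_diff_left)
        then have "g (m - 1 - 1) (e (m - 1 - 1) (face V (m - 1) i (z j)))
            = g (m - 1 - 1) (e (m - 1 - 1) (face V (m - 1) (j - 1) (z i)))"
          by simp
        moreover have "face V (m - 1) i (z j) \<in> lev V (m - 1 - 1)"
          using m2 ij j yz[OF j] by (intro F) auto
        moreover have "face V (m - 1) (j - 1) (z i) \<in> lev V (m - 1 - 1)"
          using m2 j yz[OF i] by (intro F) auto
        ultimately show ?thesis by (simp only: g)
      qed
      moreover have "z \<in> ({..m} - {k}) \<rightarrow>\<^sub>E lev V (m - 1)"
        by (intro PiE_I conjunct2[OF yz]) (auto simp: z_def)
      ultimately have "z \<in> horn V m k"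
        unfolding horn_def by (intro CollectI conjI ballI impI)
      then have "z \<in> horn_map V m k ` lev V m"
        using G2[of m k] m by simp
      then obtain x where x: "x \<in> lev V m" "z = horn_map V m k x"
        by (rule imageE)
      have "y = horn_map ?W m k (e m x)"
      proof
        fix i
        show "y i = horn_map ?W m k (e m x) i"
        proof (cases "i \<in> {..m} - {k}")
          case True
          then show ?thesis using yz[OF True] x by (simp add: hm)
        next
          case False
          then show ?thesis
            using y by (auto simp: horn_def horn_map_def PiE_def extensional_def)
        qed
      qed
      with x show "y \<in> horn_map ?W m k ` lev ?W m" by (auto simp: Wl)
    qed
  qed
  have inj: "inj_on (horn_map ?W m k) (lev ?W m)" if m: "n + 1 \<le> m" "k \<le> m" for m k
  proof (rule inj_onI)
    fix y y' assume "y \<in> lev ?W m" "y' \<in> lev ?W m"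
      and eq: "horn_map ?W m k y = horn_map ?W m k y'"
    then obtain x x' where x: "x \<in> lev V m" "y = e m x" "x' \<in> lev V m" "y' = e m x'"
      by (auto simp: Wl)
    have "horn_map V m k x = horn_map V m k x'"
    proof
      fix i
      show "horn_map V m k x i = horn_map V m k x' i"
      proof (cases "i \<in> {..m} - {k}")
        case True
        have "horn_map ?W m k y i = horn_map ?W m k y' i" using eq by simp
        then have "e (m - 1) (face V m i x) = e (m - 1) (face V m i x')"
          using True x by (simp add: horn_map_def WF)
        then have "g (m - 1) (e (m - 1) (face V m i x)) = g (m - 1) (e (m - 1) (face V m i x'))"
          by simp
        then show ?thesis using True x m F[of m i] by (simp add: g horn_map_def)
      qed (auto simp: horn_map_def)
    qed
    moreover have "inj_on (horn_map V m k) (lev V m)"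
      using G3[of m k] m by (simp add: bij_betw_def)
    ultimately show "y = y'" using x by (auto dest: inj_onD)
  qed
  show ?thesis
    unfolding VS_groupoid_def
    by (intro conjI allI impI simp surj bij_betw_imageI inj) auto
qed

definition unit_seq :: "nat \<Rightarrow> nat \<Rightarrow> real" where
  "unit_seq i = (\<lambda>a. if a = i then 1 else 0)"

definition edge_of :: "(nat \<Rightarrow> real) \<Rightarrow> nat \<times> nat \<Rightarrow> bool" where
  "edge_of v p \<longleftrightarrow> fst p < snd p \<and> v = unit_seq (fst p) + unit_seq (snd p)"

definition enc :: "nat \<Rightarrow> (nat \<times> nat \<Rightarrow> real) \<Rightarrow> (nat \<Rightarrow> real) \<Rightarrow> real" where
  "enc m x = (\<lambda>v.
     if m = 0 then 0
     else if m = 1 then (if v \<in> ker_d20 pair_nerve then x (0, 1) * v 0 else 0)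
     else if m = 2 then (if v \<in> lev pair_nerve 2
       then x (1, 2) * v 0 - x (0, 2) * v 1 + x (0, 1) * v 2 else 0)
     else (if Ex (edge_of v) then x (Eps (edge_of v)) else 0))"

definition dec :: "nat \<Rightarrow> ((nat \<Rightarrow> real) \<Rightarrow> real) \<Rightarrow> nat \<times> nat \<Rightarrow> real" where
  "dec m \<phi> = (\<lambda>(a, b).
     if m = 0 then 0
     else if m = 1 then (if (a, b) = (0, 1) then \<phi> (unit_seq 0) else 0)
     else if m = 2 then
       (if (a, b) = (1, 2) then \<phi> (unit_seq 0)
        else if (a, b) = (0, 2) then - \<phi> (unit_seq 1)
        else if (a, b) = (0, 1) then \<phi> (unit_seq 2) else 0)
     else if a < b \<and> b \<le> m then \<phi> (unit_seq a + unit_seq b) else 0)"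

lemma ker_d20_pair: "ker_d20 pair_nerve = {v. \<forall>a>0. v a = 0}"
proof -
  have "v a = 0" if "(\<lambda>a. v (cof 0 a)) = 0" "a > 0" for v :: "nat \<Rightarrow> real" and a
    using fun_cong[OF that(1), of "a - 1"] that(2) by (simp add: cof_def)
  then show ?thesis
    by (auto simp: ker_d20_def pair_nerve_def cof_def fun_eq_iff)
qed

lemma ker_p22_pair: "ker_p22 pair_nerve = {0}"
proof -
  have "v = 0" if "(\<lambda>a. v (cof 0 a)) = 0" "(\<lambda>a. v (cof 1 a)) = 0" for v :: "nat \<Rightarrow> real"
  proof
    fix a show "v a = (0 :: nat \<Rightarrow> real) a"
      using fun_cong[OF that(1), of "a - 1"] fun_cong[OF that(2), of 0]
      by (cases "a = 0") (auto simp: cof_def)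
  qed
  moreover have "v \<in> ker_p22 pair_nerve \<longleftrightarrow>
      (\<forall>a>2. v a = 0) \<and> (\<lambda>a. v (cof 0 a)) = 0 \<and> (\<lambda>a. v (cof 1 a)) = 0" for v
    unfolding ker_p22_def pair_nerve_def by simp
  moreover have "(\<lambda>a. (0 :: nat \<Rightarrow> real) (cof i a)) = 0" for i
    by (rule ext) simp
  ultimately show ?thesis
    by (intro equalityI subsetI) (simp_all add: Ball_def)
qed

lemma linear_enc: "linear (enc m)"
proof (rule linearI)
  show "enc m (x + y) = enc m x + enc m y" for x y
    by (rule ext) (simp add: enc_def algebra_simps)
  show "enc m (c *\<^sub>R x) = c *\<^sub>R enc m x" for c x
    by (rule ext) (simp add: enc_def algebra_simps)
qed

lemma unit_seq_pair_unique:
  assumes "a < b" "fst p < snd p" "unit_seq a + unit_seq b = unit_seq (fst p) + unit_seq (snd p)"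
  shows "p = (a, b)"
proof -
  have *: "t = a \<or> t = b \<longleftrightarrow> t = fst p \<or> t = snd p" for t
    using fun_cong[OF assms(3), of t] by (auto simp: unit_seq_def split: if_splits)
  show ?thesis
    using *[of a] *[of b] *[of "fst p"] *[of "snd p"] assms(1,2) by (cases p) auto
qed

lemma enc_pair:
  assumes "3 \<le> m" "a < b"
  shows "enc m x (unit_seq a + unit_seq b) = x (a, b)"
proof -
  have e: "edge_of (unit_seq a + unit_seq b) (a, b)"
    using assms by (simp add: edge_of_def)
  moreover have "Eps (edge_of (unit_seq a + unit_seq b)) = (a, b)"
    by (rule some_equality[where P = "edge_of (unit_seq a + unit_seq b)", OF e])
      (use assms unit_seq_pair_unique in \<open>unfold edge_of_def, blast\<close>)
  moreover have "enc m x v = (if Ex (edge_of v) then x (Eps (edge_of v)) else 0)" for v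
    using assms by (simp add: enc_def)
  ultimately show ?thesis
    by (metis (full_types))
qed

lemma dec_enc:
  assumes "x \<in> lev edge_model m"
  shows "dec m (enc m x) = x"
proof -
  have x0: "x (a, b) = 0" if "\<not> (a < b \<and> b \<le> m)" for a b
    using assms that by (auto simp: edge_model_def)
  consider "m = 0" | "m = 1" | "m = 2" | "3 \<le> m" by linarith
  moreover have u: "unit_seq 0 \<in> ker_d20 pair_nerve"
      "\<And>i. i \<le> 2 \<Longrightarrow> unit_seq i \<in> lev pair_nerve 2"
    unfolding ker_d20_pair by (auto simp: pair_nerve_def unit_seq_def)
  moreover have v: "unit_seq i a = (if a = i then 1 else 0)" for i a
    by (simp add: unit_seq_def)
  ultimately have "dec m (enc m x) (a, b) = x (a, b)" for a b
  proof cases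
    case 1
    then show ?thesis using x0[of a b] by (auto simp: dec_def)
  next
    case 2
    then show ?thesis using x0[of a b] u by (auto simp: dec_def enc_def v)
  next
    case 3
    have "(a, b) = (0, 1) \<or> (a, b) = (0, 2) \<or> (a, b) = (1, 2) \<or> \<not> (a < b \<and> b \<le> 2)"
      by auto
    then show ?thesis using x0[of a b] u 3 by (elim disjE) (auto simp: dec_def enc_def v)
  next
    case 4
    then show ?thesis using x0[of a b] by (auto simp: dec_def enc_pair)
  qed
  then show ?thesis by (auto simp: fun_eq_iff)
qed

lemma seq2:
  assumes "\<forall>a>2. v a = 0"
  shows "v = v 0 *\<^sub>R unit_seq 0 + v 1 *\<^sub>R unit_seq 1 + v 2 *\<^sub>R unit_seq 2"
proof
  fix a :: nat
  consider "a = 0" | "a = 1" | "a = 2" | "a > 2" by linarith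
  then show "v a = (v 0 *\<^sub>R unit_seq 0 + v 1 *\<^sub>R unit_seq 1 + v 2 *\<^sub>R unit_seq 2) a"
    using assms by cases (auto simp: unit_seq_def)
qed

lemma enc_image_2: "enc 2 ` lev edge_model 2 = dual (lev pair_nerve 2)"
proof
  show "enc 2 ` lev edge_model 2 \<subseteq> dual (lev pair_nerve 2)"
    by (auto simp: dual_def linear_on_def enc_def pair_nerve_def algebra_simps)
  show "dual (lev pair_nerve 2) \<subseteq> enc 2 ` lev edge_model 2"
  proof
    fix \<phi> assume \<phi>: "\<phi> \<in> dual (lev pair_nerve 2)"
    define L where "L = lev pair_nerve 2"
    have L: "v \<in> L \<longleftrightarrow> (\<forall>a>2. v a = 0)" for v by (simp add: L_def pair_nerve_def)
    have add: "\<phi> (u + v) = \<phi> u + \<phi> v" if "u \<in> L" "v \<in> L" for u v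
      using \<phi> that by (auto simp: dual_def linear_on_def L_def)
    have scale: "\<phi> (c *\<^sub>R u) = c * \<phi> u" if "u \<in> L" for u c
      using \<phi> that by (auto simp: dual_def linear_on_def L_def)
    have out: "\<phi> v = 0" if "v \<notin> L" for v
      using \<phi> that by (auto simp: dual_def L_def)
    have "\<phi> v = enc 2 (dec 2 \<phi>) v" for v
    proof (cases "v \<in> L")
      case True
      have "\<phi> v = \<phi> (v 0 *\<^sub>R unit_seq 0 + v 1 *\<^sub>R unit_seq 1 + v 2 *\<^sub>R unit_seq 2)"
        using True L by (intro arg_cong[of _ _ \<phi>] seq2) simp
      also have "\<dots> = v 0 * \<phi> (unit_seq 0) + v 1 * \<phi> (unit_seq 1) + v 2 * \<phi> (unit_seq 2)"
        by (simp add: add scale L unit_seq_def)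
      also have "\<dots> = enc 2 (dec 2 \<phi>) v"
        using True by (simp add: enc_def dec_def L_def)
      finally show ?thesis .
    next
      case False
      then show ?thesis by (simp add: out enc_def L_def[symmetric])
    qed
    then have "\<phi> = enc 2 (dec 2 \<phi>)" by blast
    moreover have "dec 2 \<phi> \<in> lev edge_model 2"
      by (auto simp: edge_model_def dec_def)
    ultimately show "\<phi> \<in> enc 2 ` lev edge_model 2" by blast
  qed
qed

lemma enc_image_1: "enc 1 ` lev edge_model 1 = dual (ker_d20 pair_nerve)"
proof
  show "enc 1 ` lev edge_model 1 \<subseteq> dual (ker_d20 pair_nerve)"
    by (auto simp: dual_def linear_on_def enc_def ker_d20_pair algebra_simps)
  show "dual (ker_d20 pair_nerve) \<subseteq> enc 1 ` lev edge_model 1"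
  proof
    fix \<phi> assume \<phi>: "\<phi> \<in> dual (ker_d20 pair_nerve)"
    have "\<phi> v = enc 1 (dec 1 \<phi>) v" for v
    proof (cases "v \<in> ker_d20 pair_nerve")
      case True
      then have v: "v = v 0 *\<^sub>R unit_seq 0"
        by (auto simp: ker_d20_pair unit_seq_def fun_eq_iff)
      have "\<phi> (v 0 *\<^sub>R unit_seq 0) = v 0 * \<phi> (unit_seq 0)"
        using \<phi> by (auto simp: dual_def linear_on_def ker_d20_pair unit_seq_def)
      moreover have "enc 1 (dec 1 \<phi>) v = v 0 * \<phi> (unit_seq 0)"
        using True by (simp add: enc_def dec_def)
      ultimately show ?thesis using arg_cong[OF v, of \<phi>] by (simp only:)
    next
      case False
      then show ?thesis using \<phi> by (simp add: dual_def enc_def)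
    qed
    then have "\<phi> = enc 1 (dec 1 \<phi>)" by blast
    moreover have "dec 1 \<phi> \<in> lev edge_model 1"
      by (auto simp: edge_model_def dec_def)
    ultimately show "\<phi> \<in> enc 1 ` lev edge_model 1" by blast
  qed
qed

lemma enc_image_0: "enc 0 ` lev edge_model 0 = dual (ker_p22 pair_nerve)"
proof -
  have "\<phi> = 0" if "\<phi> \<in> dual {0 :: nat \<Rightarrow> real}" for \<phi>
  proof
    fix x
    have "\<phi> (0 *\<^sub>R 0) = 0 *\<^sub>R \<phi> 0" using that unfolding dual_def linear_on_def by blast
    then show "\<phi> x = (0 :: (nat \<Rightarrow> real) \<Rightarrow> real) x"
      using that by (cases "x = 0") (auto simp: dual_def)
  qed
  moreover have "0 \<in> dual {0 :: nat \<Rightarrow> real}"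
    by (auto simp: dual_def linear_on_def)
  moreover have "enc 0 x = 0" for x by (auto simp: enc_def fun_eq_iff)
  moreover have "(0 :: nat \<times> nat \<Rightarrow> real) \<in> lev edge_model 0" by (simp add: edge_model_def)
  ultimately show ?thesis by (auto simp: ker_p22_pair image_iff)
qed

theorem K_star_pair_nerve_exists: "\<exists>W. is_K_star pair_nerve W"
proof -
  let ?W = "transport enc dec edge_model"
  have VS: "VS_groupoid 2 ?W"
  proof (rule VS_groupoid_transport)
    show "VS_groupoid 2 edge_model" by (rule VS_groupoid_edge_model)
    show "linear (enc m)" for m by (rule linear_enc)
    show "dec m (enc m x) = x" if "x \<in> lev edge_model m" for m x
      using that by (rule dec_enc)
  qed
  have l: "lev ?W m = enc m ` lev edge_model m" for m
    by (simp add: transport_def)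
  have F: "face ?W m i (enc m x) = enc (m - 1) (face edge_model m i x)"
    and D: "degen ?W m i (enc m x) = enc (m + 1) (degen edge_model m i x)"
    if "x \<in> lev edge_model m" for m i x
    using that by (simp_all add: transport_def dec_enc)
  have F2: "face ?W 2 i (enc 2 x) = enc 1 (face edge_model 2 i x)" if "x \<in> lev edge_model 2" for i x
    using F[OF that] by simp
  have F1: "face ?W 1 i (enc 1 x) = enc 0 (face edge_model 1 i x)" if "x \<in> lev edge_model 1" for i x
    using F[OF that] by simp
  have D1: "degen ?W 1 i (enc 1 x) = enc 2 (degen edge_model 1 i x)" if "x \<in> lev edge_model 1" for i x
    using D[OF that] by (simp add: numeral_2_eq_2)
  have D0: "degen ?W 0 i (enc 0 x) = enc 1 (degen edge_model 0 i x)" if "x \<in> lev edge_model 0" for i x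
    using D[OF that] by simp
  have sel: "lev pair_nerve m = {v. \<forall>a>m. v a = 0}"
      "face pair_nerve m i v = (\<lambda>a. v (cof i a))"
      "degen pair_nerve m i v = (\<lambda>a. v (codeg i a))"
      "face edge_model m i x = (\<lambda>(a, b). x (cof i a, cof i b))"
      "degen edge_model m i x = (\<lambda>(a, b). x (codeg i a, codeg i b))" for m i v x
    by (simp_all add: pair_nerve_def edge_model_def)
  note eqs = sel cof_def codeg_def enc_def ker_d20_pair numeral_2_eq_2
  have "is_K_star pair_nerve ?W"
    unfolding is_K_star_def Let_def
    unfolding l enc_image_0 enc_image_1 enc_image_2
    unfolding enc_image_0[symmetric] enc_image_1[symmetric] enc_image_2[symmetric]
  proof (intro conjI ballI refl, goal_cases)
    case 1 show ?case by (rule VS)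
  next
    case (2 \<phi> h)
    then obtain x where x: "x \<in> lev edge_model 2" "\<phi> = enc 2 x" by blast
    have "\<forall>a>0. h a = 0" using 2(2) by (simp add: ker_d20_pair)
    then show ?case using 2(2) x(1) unfolding x(2) F2[OF x(1)] by (simp add: eqs)
  next
    case (3 \<phi> h)
    then obtain x where x: "x \<in> lev edge_model 2" "\<phi> = enc 2 x" by blast
    have "\<forall>a>0. h a = 0" using 3(2) by (simp add: ker_d20_pair)
    then show ?case using 3(2) x(1) unfolding x(2) F2[OF x(1)] by (simp add: eqs)
  next
    case (4 \<phi> h)
    then obtain x where x: "x \<in> lev edge_model 2" "\<phi> = enc 2 x" by blast
    have "\<forall>a>0. h a = 0" using 4(2) by (simp add: ker_d20_pair)
    then show ?case using 4(2) x(1) unfolding x(2) F2[OF x(1)] by (simp add: eqs)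
  next
    case (5 \<nu> k)
    then obtain x where x: "x \<in> lev edge_model 1" "\<nu> = enc 1 x" by blast
    have "k = 0" using 5(2) by (simp add: ker_p22_pair)
    then show ?case unfolding x(2) F1[OF x(1)] by (simp add: eqs)
  next
    case (6 \<nu> k)
    then obtain x where x: "x \<in> lev edge_model 1" "\<nu> = enc 1 x" by blast
    have "k = 0" using 6(2) by (simp add: ker_p22_pair)
    then show ?case unfolding x(2) F1[OF x(1)] by (simp add: eqs)
  next
    case (7 \<nu> v)
    then obtain x where x: "x \<in> lev edge_model 1" "\<nu> = enc 1 x" by blast
    have x0: "x (a, a) = 0" for a using x(1) by (simp add: edge_model_def)
    have "\<forall>a>2. v a = 0" using 7(2) by (simp add: pair_nerve_def)
    then show ?case using 7(2) x(1) unfolding x(2) D1[OF x(1)] by (simp add: x0 eqs algebra_simps)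
  next
    case (8 \<nu> v)
    then obtain x where x: "x \<in> lev edge_model 1" "\<nu> = enc 1 x" by blast
    have x0: "x (a, a) = 0" for a using x(1) by (simp add: edge_model_def)
    have v: "\<forall>a>2. v a = 0" using 8(2) by (simp add: pair_nerve_def)
    let ?u = "v - degen pair_nerve 1 0 (face pair_nerve 2 0 v)
        - degen pair_nerve 1 1 (face pair_nerve 2 1 v)
        + degen pair_nerve 1 0 (degen pair_nerve 0 0 (face pair_nerve 1 0 (face pair_nerve 2 0 v)))"
    have "?u a = 0" if a: "a > 0" for a
    proof -
      consider "a = 1" | "a = 2" | "a > 2" using a by linarith
      then show ?thesis using v by cases (simp_all add: sel cof_def codeg_def numeral_2_eq_2)
    qed
    then have "?u \<in> ker_d20 pair_nerve"
      unfolding ker_d20_pair by blast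
    then have "enc 1 x ?u = x (0, 1) * ?u 0"
      by (simp add: enc_def)
    also have "?u 0 = v 2 - v 1"
      by (simp add: sel cof_def codeg_def numeral_2_eq_2)
    finally have u: "enc 1 x ?u = x (0, 1) * (v 2 - v 1)" .
    have "enc 2 (degen edge_model 1 1 x) v = x (0, 1) * (v 2 - v 1)"
      using 8(2) by (simp add: x0 enc_def sel(5) codeg_def algebra_simps)
    then show ?case
      unfolding x(2) D1[OF x(1)] u .
  next
    case (9 \<theta> h)
    then obtain x where x: "x \<in> lev edge_model 0" "\<theta> = enc 0 x" by blast
    have "x (a, b) = 0" for a b using x(1) by (simp add: edge_model_def)
    then show ?case unfolding x(2) D0[OF x(1)] by (simp add: eqs)
  qed
  then show ?thesis by blast
qed

end

theory Submission
  imports Defs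
begin

text \<open>The cocycle condition is tested on a degenerate 3-simplex \<open>s\<^sub>0 \<phi>\<close> of the 2-dual. Its faces are
  \<open>\<phi>, \<phi>, s\<^sub>0 d\<^sub>1 \<phi>, s\<^sub>0 d\<^sub>2 \<phi>\<close>, so multiplicativity against a 3-simplex \<open>y\<close> reads
  \<open>\<phi>(d\<^sub>0 y) - \<phi>(d\<^sub>1 y) + (s\<^sub>0 d\<^sub>1 \<phi>)(d\<^sub>2 y) - (s\<^sub>0 d\<^sub>2 \<phi>)(d\<^sub>3 y) = 0\<close>. For a functional
  \<open>\<phi>(v) = \<phi>\<^sub>0 v\<^sub>0 + \<phi>\<^sub>1 v\<^sub>1 + \<phi>\<^sub>2 v\<^sub>2\<close> the left-hand side is
  \<open>(\<phi>\<^sub>0 + \<phi>\<^sub>1 + \<phi>\<^sub>2) (y\<^sub>1 - y\<^sub>0)\<close>: the obstruction is the value of \<open>\<phi>\<close> on the constant vectors,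
  that is, on the totally degenerate 2-simplices.

  The simplest functional with a nonzero obstruction is \<open>\<phi>(v) = v\<^sub>0\<close>. Its faces \<open>d\<^sub>1 \<phi>\<close> and
  \<open>d\<^sub>2 \<phi>\<close> vanish (\<open>K_star_vertex0_faces\<close>), because both evaluate \<open>\<phi>\<close> on vectors whose entry with
  index 0 cancels. The last two terms of the condition then disappear, and \<open>y = (0, 1, 0, 0)\<close>
  gives \<open>y\<^sub>1 - y\<^sub>0 = 1\<close>.\<close>

definition vertex0 :: "(nat \<Rightarrow> real) \<Rightarrow> real" where
  "vertex0 v = (if v \<in> lev pair_nerve 2 then v 0 else 0)"

lemma vertex0_in_dual: "vertex0 \<in> dual (lev pair_nerve 2)"
  by (auto simp: dual_def linear_on_def vertex0_def pair_nerve_def)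

lemma simplicial_vs_level:
  assumes "simplicial_vs V"
  shows zero_in_level: "0 \<in> lev V m"
    and face_in_level: "\<lbrakk>1 \<le> m; i \<le> m; x \<in> lev V m\<rbrakk> \<Longrightarrow> face V m i x \<in> lev V (m - 1)"
    and degen_in_level: "\<lbrakk>i \<le> m; x \<in> lev V m\<rbrakk> \<Longrightarrow> degen V m i x \<in> lev V (m + 1)"
    and linear_degen: "i \<le> m \<Longrightarrow> linear_on (lev V m) (degen V m i)"
proof -
  note S = assms[unfolded simplicial_vs_def]
  have "fin_dim_subspace (lev V m)"
    using S[THEN conjunct1] by blast
  then show "0 \<in> lev V m"
    unfolding fin_dim_subspace_def using span_zero by blast
  show "face V m i x \<in> lev V (m - 1)" if "1 \<le> m" "i \<le> m" "x \<in> lev V m"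
    using S[THEN conjunct2, THEN conjunct1] that by blast
  note D = S[THEN conjunct2, THEN conjunct2, THEN conjunct1]
  show "degen V m i x \<in> lev V (m + 1)" if "i \<le> m" "x \<in> lev V m"
    using D that by blast
  show "linear_on (lev V m) (degen V m i)" if "i \<le> m"
    using D that by blast
qed

lemma simplicial_vs_degen0_faces:
  assumes V: "simplicial_vs V" and x: "x \<in> lev V m"
  shows "face V (m + 1) 0 (degen V m 0 x) = x"
    and "face V (m + 1) 1 (degen V m 0 x) = x"
    and "1 < i \<Longrightarrow> i \<le> m + 1 \<Longrightarrow>
      face V (m + 1) i (degen V m 0 x) = degen V (m - 1) 0 (face V m (i - 1) x)"
proof -
  note S = V[unfolded simplicial_vs_def, THEN conjunct2, THEN conjunct2, THEN conjunct2,
      THEN conjunct2, THEN conjunct2, THEN conjunct2]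
  note S_id = S[THEN conjunct1, rule_format, OF x]
    and S_shift = S[THEN conjunct2, rule_format, OF x]
  show "face V (m + 1) 0 (degen V m 0 x) = x" "face V (m + 1) 1 (degen V m 0 x) = x"
    by (rule S_id; simp)+
  show "face V (m + 1) i (degen V m 0 x) = degen V (m - 1) 0 (face V m (i - 1) x)"
    if "1 < i" "i \<le> m + 1"
    by (rule S_shift) (use that in simp)
qed

lemma dual_eq_0:
  assumes "\<phi> \<in> dual S" and "\<And>h. h \<in> S \<Longrightarrow> \<phi> h = 0"
  shows "\<phi> = 0"
  using assms by (fastforce simp: dual_def fun_eq_iff)

text \<open>The entry with index 0 of \<open>h\<close> is untouched by \<open>d\<^sub>1\<close>, \<open>d\<^sub>2\<close> and all degeneracies, so the terms
  \<open>h - s\<^sub>0 d\<^sub>1 h\<close> and \<open>h - s\<^sub>0 d\<^sub>1 h - s\<^sub>1 d\<^sub>2 h + 1 d\<^sub>1 d\<^sub>1 h\<close> have entry 0 there.\<close>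

lemma K_star_vertex0_faces:
  assumes K: "is_K_star pair_nerve W"
  shows "face W 2 1 vertex0 = 0" and "face W 2 2 vertex0 = 0"
proof -
  have S: "simplicial_vs W" and L1: "lev W 1 = dual (ker_d20 pair_nerve)"
    and L2: "vertex0 \<in> lev W 2"
    using K vertex0_in_dual by (simp_all add: is_K_star_def VS_groupoid_def)
  have in_dual: "face W 2 i vertex0 \<in> dual (ker_d20 pair_nerve)" if "i \<le> 2" for i
    using face_in_level[OF S _ that L2] L1 by simp
  have eq: "face W 2 1 vertex0 h
        = vertex0 (h - degen pair_nerve 1 0 (face pair_nerve 2 1 h))"
      "face W 2 2 vertex0 h
        = vertex0 (h - degen pair_nerve 1 0 (face pair_nerve 2 1 h)
            - degen pair_nerve 1 1 (face pair_nerve 2 2 h)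
            + degen pair_nerve 1 0 (degen pair_nerve 0 0
                (face pair_nerve 1 1 (face pair_nerve 2 1 h))))"
    if "h \<in> ker_d20 pair_nerve" for h
    using K[unfolded is_K_star_def Let_def, THEN conjunct2, THEN conjunct2, THEN conjunct2,
        THEN conjunct2, THEN conjunct1, rule_format, OF L2 that]
    by blast+
  have "face W 2 1 vertex0 h = 0" "face W 2 2 vertex0 h = 0"
    if "h \<in> ker_d20 pair_nerve" for h
    unfolding eq[OF that] by (simp_all add: vertex0_def pair_nerve_def cof_def codeg_def)
  then show "face W 2 1 vertex0 = 0" "face W 2 2 vertex0 = 0"
    using in_dual[of 1] in_dual[of 2] by (simp_all add: dual_eq_0)
qed

theorem propositionA2:
  fixes W :: "((nat \<Rightarrow> real) \<Rightarrow> real) simplicial"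
  assumes "is_K_star pair_nerve W"
  shows "\<not> multiplicative 2 W pair_nerve evaluation"
proof
  assume mult: "multiplicative 2 W pair_nerve evaluation"
  have S: "simplicial_vs W" and \<phi>: "vertex0 \<in> lev W 2"
    using assms vertex0_in_dual by (simp_all add: is_K_star_def VS_groupoid_def)
  define w where "w = degen W 2 0 vertex0"
  define y where "y = unit_seq 1"
  have y: "y \<in> lev pair_nerve 3"
    by (auto simp: y_def unit_seq_def pair_nerve_def)
  have zero: "degen W 1 0 0 = 0"
  proof -
    have "degen W 1 0 (0 *\<^sub>R 0) = 0 *\<^sub>R degen W 1 0 0"
      using linear_degen[OF S, of 0 1] zero_in_level[OF S, of 1]
      unfolding linear_on_def by blast
    then show ?thesis by simp
  qed
  have w: "w \<in> lev W 3"
    using degen_in_level[OF S _ \<phi>, of 0] by (simp add: w_def)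
  note deg = simplicial_vs_degen0_faces[OF S \<phi>, folded w_def]
  have f: "face W 3 0 w = vertex0" "face W 3 1 w = vertex0"
    using deg(1,2) by simp_all
  have f2: "face W 3 2 w = 0" "face W 3 3 w = 0"
    using deg(3)[of 2] deg(3)[of 3] K_star_vertex0_faces[OF assms] zero by simp_all
  have "(\<Sum>i\<le>3. (- 1) ^ i * evaluation (face W 3 i w) (face pair_nerve 3 i y)) = 0"
    using mult w y unfolding multiplicative_def by simp
  then have "vertex0 (face pair_nerve 3 0 y) - vertex0 (face pair_nerve 3 1 y) = 0"
    using f f2 by (simp add: evaluation_def numeral_3_eq_3 numeral_2_eq_2)
  moreover have "vertex0 (face pair_nerve 3 0 y) = 1" "vertex0 (face pair_nerve 3 1 y) = 0"
    by (auto simp: vertex0_def y_def unit_seq_def pair_nerve_def cof_def)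
  ultimately show False by simp
qed

end
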